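(* Let $I=(0,1)$ or $I=(0,\infty)$. Then the quasi-Banach spaces $(L_{1,\infty}(I),\|\cdot\|_{1,\infty})$ and $(\ell_{1,\infty},\|\cdot\|_{1,\infty})$ do not have type $1$. In particular, neither $L_{1,\infty}(I)$ nor $\ell_{1,\infty}$ is normable, i.e. on neither space does there exist a norm equivalent to the quasi-norm $\|\cdot\|_{1,\infty}$.
   Context: Rademacher functions: for $n\in\mathbb N=\{1,2,\dots\}$, $r_n:[0,1]\to\mathbb R$ is $r_n(t)=\operatorname{sign}(\sin 2^n\pi t)$. Type $1$: a quasi-Banach space $(X,\|\cdot\|)$ has type $1$ if there is a constant $K>0$ such that for any choice of finitely many vectors $x_1,\dots,x_n\in X$, $$\int_0^1\Big\|\sum_{k=1}^n r_k(t)x_k\Big\|\,dt\le K\sum_{k=1}^n\|x_k\|.$$ Distribution function and decreasing rearrangement: $|\cdot|$ applied to sets denotes Lebesgue measure on $\mathbb R$. For a real-valued measurable function $f$ on $I$, $d_f(\lambda)=|\{x\in I: |f(x)|>\lambda\}|$ for $\lambda\ge 0$, and $f^*(t)=\inf\{s>0: d_f(s)\le t\}$ for $t\in I$. Weak-$L^1$ space: $L_{1,\infty}(I)$ is the space of all real-valued measurable functions $f$ on $I$ (functions equal almost everywhere being identified) such that $\|f\|_{1,\infty}=\sup_{t\in I} t f^*(t)<\infty$; with $\|\cdot\|_{1,\infty}$ it is a complete quasi-normed space. Weak-$\ell^1$ space: for a bounded real sequence $x=\{x(n)\}_{n\ge1}$, let $f(t)=\sum_{n=1}^\infty x(n)\chi_{[n-1,n)}(t)$,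 $t\ge 0$, and let $x^*(n)=f^*(n-1)$, $n\in\mathbb N$, where $f^*(t)=\inf\{s>0: d_f(s)\le t\}$ for $t\ge 0$, with $d_f$ the distribution function of $f$ on $[0,\infty)$. Then $\ell_{1,\infty}$ is the space of all such sequences $x$ with $\|x\|_{1,\infty}=\sup_{n} n\,x^*(n)<\infty$; with $\|\cdot\|_{1,\infty}$ it is a quasi-Banach space. *)

theory Defs
  imports "HOL-Analysis.Analysis"
begin

definition rademacher :: "nat \<Rightarrow> real \<Rightarrow> real" where
  "rademacher n t = sgn (sin (2 ^ n * pi * t))"

text \<open>In the following two definitions, a quasi-normed space is given by its underlying
  subspace \<open>V\<close> of an ambient real vector space together with its quasi-norm \<open>N\<close>.\<close>

definition has_type_one :: "'v::real_vector set \<Rightarrow> ('v \<Rightarrow> real) \<Rightarrow> bool" where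
  "has_type_one V N \<longleftrightarrow>
     (\<exists>K>0. \<forall>n. \<forall>x :: nat \<Rightarrow> 'v. (\<forall>k\<in>{1..n}. x k \<in> V) \<longrightarrow>
        (LINT t:{0..1}|lborel. N (\<Sum>k=1..n. rademacher k t *\<^sub>R x k)) \<le> K * (\<Sum>k=1..n. N (x k)))"

definition is_norm_on :: "'v::real_vector set \<Rightarrow> ('v \<Rightarrow> real) \<Rightarrow> bool" where
  "is_norm_on V p \<longleftrightarrow>
     (\<forall>x\<in>V. 0 \<le> p x \<and> (p x = 0 \<longleftrightarrow> x = 0)) \<and>
     (\<forall>a. \<forall>x\<in>V. p (a *\<^sub>R x) = \<bar>a\<bar> * p x) \<and>
     (\<forall>x\<in>V. \<forall>y\<in>V. p (x + y) \<le> p x + p y)"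

definition normable :: "'v::real_vector set \<Rightarrow> ('v \<Rightarrow> real) \<Rightarrow> bool" where
  "normable V N \<longleftrightarrow>
     (\<exists>p. is_norm_on V p \<and> (\<exists>c>0. \<exists>C>0. \<forall>x\<in>V. c * N x \<le> p x \<and> p x \<le> C * N x))"

text \<open>The value is in \<open>ennreal\<close>, so that the infimum of the empty set is \<open>\<infinity>\<close>.\<close>

definition distribution :: "real set \<Rightarrow> (real \<Rightarrow> real) \<Rightarrow> real \<Rightarrow> ennreal" where
  "distribution I f s = emeasure lebesgue {x \<in> I. \<bar>f x\<bar> > s}"

definition rearrangement :: "real set \<Rightarrow> (real \<Rightarrow> real) \<Rightarrow> real \<Rightarrow> ennreal" where
  "rearrangement I f t = (INF s\<in>{s. s > 0 \<and> distribution I f s \<le> ennreal t}. ennreal s)"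

text \<open>Real-valued Lebesgue measurable functions modulo equality almost everywhere.\<close>

quotient_type L0 = "real \<Rightarrow> real" / partial:
  "\<lambda>f g. f \<in> borel_measurable lebesgue \<and> g \<in> borel_measurable lebesgue \<and>
     (AE x in lebesgue. f x = g x)"
proof (rule part_equivpI)
  show "\<exists>f::real \<Rightarrow> real. f \<in> borel_measurable lebesgue \<and> f \<in> borel_measurable lebesgue \<and>
      (AE x in lebesgue. f x = f x)"
    by (rule exI[of _ "\<lambda>_. 0"]) simp
qed (auto intro!: sympI transpI)

instantiation L0 :: real_vector
begin

lift_definition zero_L0 :: L0 is "\<lambda>_. 0" by simp
lift_definition plus_L0 :: "L0 \<Rightarrow> L0 \<Rightarrow> L0" is "\<lambda>f g x. f x + g x" by auto
lift_definition minus_L0 :: "L0 \<Rightarrow> L0 \<Rightarrow> L0" is "\<lambda>f g x. f x - g x" by auto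
lift_definition uminus_L0 :: "L0 \<Rightarrow> L0" is "\<lambda>f x. - f x" by auto
lift_definition scaleR_L0 :: "real \<Rightarrow> L0 \<Rightarrow> L0" is "\<lambda>c f x. c * f x" by auto

instance
  by standard (transfer; auto simp: algebra_simps)+

end

text \<open>Measurable functions on \<open>I\<close> are extended by zero to the real line.\<close>

lift_definition vanishes_off :: "real set \<Rightarrow> L0 \<Rightarrow> bool" is
  "\<lambda>I f. AE x in lebesgue. x \<notin> I \<longrightarrow> f x = 0"
  by auto

lemma emeasure_lebesgue_cong_AE:
  fixes A B :: "real set"
  assumes "AE x in lebesgue. x \<in> A \<longleftrightarrow> x \<in> B"
  shows "emeasure lebesgue A = emeasure lebesgue B"
proof -
  have le: "D \<in> sets lebesgue" if "C \<in> sets lebesgue" and ae: "AE x in lebesgue. x \<in> C \<longleftrightarrow> x \<in> D"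
    for C D :: "real set"
  proof -
    obtain N where N: "N \<in> null_sets lebesgue" "{x. \<not> (x \<in> C \<longleftrightarrow> x \<in> D)} \<subseteq> N"
      using ae unfolding eventually_ae_filter by auto
    have "D - C \<in> sets lebesgue" "C - D \<in> sets lebesgue"
      using N null_sets_completion_subset[of _ N lborel] by blast+
    moreover have "D = (C - (C - D)) \<union> (D - C)" by blast
    ultimately show ?thesis using that(1) by (metis sets.Diff sets.Un)
  qed
  have "AE x in lebesgue. x \<in> B \<longleftrightarrow> x \<in> A"
    using assms by eventually_elim blast
  then have iff: "A \<in> sets lebesgue \<longleftrightarrow> B \<in> sets lebesgue"
    using le[of A B] le[of B A] assms by blast
  show ?thesis
  proof (cases "A \<in> sets lebesgue")
    case True
    then show ?thesis
      using iff assms by (intro emeasure_eq_AE) blast+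
  next
    case False
    then show ?thesis
      using iff by (simp add: emeasure_notin_sets)
  qed
qed

lemma distribution_cong_AE:
  assumes "AE x in lebesgue. f x = g x"
  shows "distribution I f = distribution I g"
proof
  fix s
  have "AE x in lebesgue. x \<in> {x \<in> I. \<bar>f x\<bar> > s} \<longleftrightarrow> x \<in> {x \<in> I. \<bar>g x\<bar> > s}"
    using assms by eventually_elim simp
  then show "distribution I f s = distribution I g s"
    unfolding distribution_def by (rule emeasure_lebesgue_cong_AE)
qed

lift_definition weak_L1_enorm :: "real set \<Rightarrow> L0 \<Rightarrow> ennreal" is
  "\<lambda>I f. SUP t\<in>I. ennreal t * rearrangement I f t"
proof -
  fix I :: "real set" and f g :: "real \<Rightarrow> real"
  assume "f \<in> borel_measurable lebesgue \<and> g \<in> borel_measurable lebesgue \<and>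
    (AE x in lebesgue. f x = g x)"
  then have "distribution I f = distribution I g"
    by (simp add: distribution_cong_AE)
  then show "(SUP t\<in>I. ennreal t * rearrangement I f t) = (SUP t\<in>I. ennreal t * rearrangement I g t)"
    by (simp add: rearrangement_def)
qed

definition weak_L1 :: "real set \<Rightarrow> L0 set" where
  "weak_L1 I = {f. vanishes_off I f \<and> weak_L1_enorm I f < \<infinity>}"

definition weak_L1_norm :: "real set \<Rightarrow> L0 \<Rightarrow> real" where
  "weak_L1_norm I f = enn2real (weak_L1_enorm I f)"

text \<open>The type \<open>nat \<Rightarrow>\<^sub>C real\<close> consists of the bounded real sequences, since \<open>nat\<close> is discrete.
  Sequences are indexed from 0: the entry with index \<open>i\<close> is \<open>x(i + 1)\<close>.\<close>

definition step_fun :: "(nat \<Rightarrow>\<^sub>C real) \<Rightarrow> real \<Rightarrow> real" where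
  "step_fun x t = (\<Sum>i. apply_bcontfun x i * indicator {real i..<real i + 1} t)"

definition weak_l1_enorm :: "(nat \<Rightarrow>\<^sub>C real) \<Rightarrow> ennreal" where
  "weak_l1_enorm x = (SUP i. of_nat (i + 1) * rearrangement {0..} (step_fun x) (real i))"

definition weak_l1 :: "(nat \<Rightarrow>\<^sub>C real) set" where
  "weak_l1 = {x. weak_l1_enorm x < \<infinity>}"

definition weak_l1_norm :: "(nat \<Rightarrow>\<^sub>C real) \<Rightarrow> real" where
  "weak_l1_norm x = enn2real (weak_l1_enorm x)"

end

theory Submission imports Defs begin

text \<open>
  Weak \<open>L\<^sub>1\<close> contains, for each \<open>n\<close>, vectors \<open>x\<^sub>1, \<dots>, x\<^sub>n\<close> with quasi-norms at most 2 such that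
  \<open>\<Sum> e\<^sub>k x\<^sub>k\<close> has quasi-norm at least \<open>n H\<^sub>n\<close> for \<^emph>\<open>every\<close> choice of signs \<open>e\<^sub>k\<close>, where \<open>H\<^sub>n\<close> is the
  harmonic number. Since \<open>H\<^sub>n\<close> is unbounded, neither a type 1 inequality nor an equivalent norm can exist.

  For the signs \<open>e\<^sub>k = 1\<close> the classical example consists of \<open>n\<close> shifts of \<open>1/t\<close>, with a sum of order
  \<open>n log n\<close>; for most other signs the shifts largely cancel. Moreover, at each single level \<open>s\<close> the
  expected distribution function of a Rademacher sum is bounded by \<open>(C/s) \<Sum> \<parallel>x\<^sub>k\<parallel>\<close>, so that type 1 can
  only fail if the level at which the sum is large varies with the signs. Therefore each of the
  \<open>2\<^sup>n\<close> sign vectors \<open>\<sigma>\<close> gets its own block of the underlying set, and in this block \<open>x\<^sub>k\<close> is \<open>\<sigma>\<^sub>k\<close> times a cyclic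
  shift of \<open>1, 1/2, \<dots>, 1/n\<close>. The blocks are rescaled to widely separated heights, each with weak
  norm at most 1. The heights decay geometrically, so that each \<open>x\<^sub>k\<close> still has weak norm at most 2,
  while the signed sum with \<open>e = \<sigma>\<close> is the constant \<open>H\<^sub>n\<close> times the height on the block of \<open>\<sigma>\<close>
  (lemma \<open>vectors_with_large_signed_sums\<close>).

  Finite sequences embed into both spaces with proportional quasi-norms, as step functions over cells
  of equal length (\<open>weak_L1_has_copies\<close>, \<open>weak_l1_has_copies\<close>), and everything else is done for an
  arbitrary space with such embeddings.
\<close>

section \<open>Finite sequences with large signed sums\<close>

text \<open>The quasi-norm of weak \<open>\<ell>\<^sub>1\<close> on the first \<open>S\<close> coordinates, in the form
  \<open>sup s d(s)\<close> instead of \<open>sup t f\<^sup>*(t)\<close>: counting superlevel sets is easier than sorting.\<close>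

definition weak_norm :: "nat \<Rightarrow> (nat \<Rightarrow> real) \<Rightarrow> real" where
  "weak_norm S a = (SUP s\<in>{0<..}. s * real (card {i. i < S \<and> s < \<bar>a i\<bar>}))"

lemma bdd_above_weak_norm:
  fixes S :: nat and a :: "nat \<Rightarrow> real"
  shows "bdd_above ((\<lambda>s. s * real (card {i. i < S \<and> s < \<bar>a i\<bar>})) ` {0<..})"
proof (rule bdd_aboveI2)
  fix s :: real assume s: "s \<in> {0<..}"
  let ?B = "\<Sum>i<S. \<bar>a i\<bar>"
  have card: "card {i. i < S \<and> s < \<bar>a i\<bar>} \<le> S"
    using card_mono[of "{..<S}" "{i. i < S \<and> s < \<bar>a i\<bar>}"] by auto
  show "s * real (card {i. i < S \<and> s < \<bar>a i\<bar>}) \<le> ?B * real S"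
  proof (cases "\<exists>i<S. s < \<bar>a i\<bar>")
    case True
    then obtain i where "i < S" "s < \<bar>a i\<bar>" by blast
    then have "s \<le> ?B" using member_le_sum[of i "{..<S}" "\<lambda>i. \<bar>a i\<bar>"] by simp
    then show ?thesis using card s by (intro mult_mono) auto
  next
    case False
    then have "{i. i < S \<and> s < \<bar>a i\<bar>} = {}" by blast
    then show ?thesis by (simp only: card.empty) (simp add: sum_nonneg)
  qed
qed

lemma weak_norm_upper: "s > 0 \<Longrightarrow> s * real (card {i. i < S \<and> s < \<bar>a i\<bar>}) \<le> weak_norm S a"
  unfolding weak_norm_def by (rule cSUP_upper[OF _ bdd_above_weak_norm]) simp

lemma weak_norm_least:
  "(\<And>s. s > 0 \<Longrightarrow> s * real (card {i. i < S \<and> s < \<bar>a i\<bar>}) \<le> C) \<Longrightarrow> weak_norm S a \<le> C"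
  unfolding weak_norm_def by (rule cSUP_least) auto

lemma weak_norm_nonneg: "weak_norm S a \<ge> 0"
  using weak_norm_upper[of 1 S a] by (simp add: order_trans[rotated])

lemma cyclic_shift_bij: "bij_betw (\<lambda>i. (i + k) mod n) {..<n} {..<n::nat}"
proof -
  have "inj_on (\<lambda>i. (i + k) mod n) {..<n}"
  proof (rule linorder_inj_onI)
    fix i j assume "i < j" "i \<in> {..<n}" "j \<in> {..<n}"
    then have "\<not> n dvd (j + k) - (i + k)" by (auto dest: dvd_imp_le)
    with \<open>i < j\<close> show "(i + k) mod n \<noteq> (j + k) mod n"
      using mod_eq_dvd_iff_nat[of "i + k" "j + k" n] by auto
  qed auto
  moreover have "(\<lambda>i. (i + k) mod n) ` {..<n} \<subseteq> {..<n}"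
    by auto
  ultimately show ?thesis
    by (simp add: bij_betw_def endo_inj_surj)
qed

text \<open>The shifted profiles \<open>1/(1 + (i + k) mod n)\<close> add up to the same constant in every cell \<open>i\<close>,
  because for fixed \<open>i\<close> the shifts run once through all residues.\<close>

lemma sum_cyclic_reciprocals: "(\<Sum>k=1..n. 1 / (1 + real ((i + k) mod n))) = (harm n :: real)"
proof -
  have "(\<Sum>k=1..n. 1 / (1 + real ((i + k) mod n))) = (\<Sum>k<n. 1 / (1 + real ((k + Suc i) mod n)))"
    by (rule sum.reindex_bij_witness[of _ Suc "\<lambda>k. k - 1"]) (auto simp: add_ac)
  also have "\<dots> = (\<Sum>r<n. 1 / (1 + real r))"
    by (rule sum.reindex_bij_betw[OF cyclic_shift_bij])
  also have "\<dots> = harm n"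
    unfolding harm_def
    by (rule sum.reindex_bij_witness[of _ "\<lambda>k. k - 1" Suc]) (auto simp: divide_simps)
  finally show ?thesis .
qed

lemma card_reciprocals_le:
  fixes y :: real
  assumes "y > 0"
  shows "y * real (card {r. r < n \<and> (1 + real r) * y < 1}) \<le> 1"
proof -
  have "{r. r < n \<and> (1 + real r) * y < 1} \<subseteq> {..<nat \<lfloor>1 / y\<rfloor>}"
  proof
    fix r assume "r \<in> {r. r < n \<and> (1 + real r) * y < 1}"
    then have "real r + 1 \<le> 1 / y" using assms by (simp add: field_simps)
    then show "r \<in> {..<nat \<lfloor>1 / y\<rfloor>}" by (simp add: le_floor_iff) linarith
  qed
  from card_mono[OF _ this] have "card {r. r < n \<and> (1 + real r) * y < 1} \<le> nat \<lfloor>1 / y\<rfloor>"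
    by simp
  then have "real (card {r. r < n \<and> (1 + real r) * y < 1}) \<le> 1 / y"
    using assms by (smt (verit) of_int_floor_le of_nat_mono of_nat_nat zero_le_floor divide_nonneg_nonneg)
  then show ?thesis using assms by (simp add: field_simps)
qed

text \<open>Summand \<open>j\<close> counts the entries above \<open>s\<close> of one profile \<open>1, 1/2, \<dots>, 1/n\<close> that is repeated
  \<open>m\<^sub>j = (n + 1)\<^sup>j\<close> times and divided by \<open>m\<^sub>j\<close>. Each such block has weak norm at most 1. Superposing them
  costs only a factor 2: once block \<open>M\<close> is visible at level \<open>s\<close>, all lower blocks together have
  \<open>n (1 + (n + 1) + \<dots> + (n + 1)\<^sup>M\<^sup>-\<^sup>1) < m\<^sub>M < 1/s\<close> entries. The ratio \<open>n + 1\<close> of the scales is chosen for this.\<close>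

lemma card_superlevel_scaled_blocks:
  fixes s :: real
  assumes "s > 0"
  shows "s * (\<Sum>j<M. (real n + 1) ^ j * real (card {r. r < n \<and> (1 + real r) * (s * (real n + 1) ^ j) < 1})) \<le> 2"
proof (induction M)
  case (Suc M)
  let ?m = "\<lambda>j. (real n + 1) ^ j"
  let ?q = "\<lambda>j. card {r. r < n \<and> (1 + real r) * (s * ?m j) < 1}"
  show ?case
  proof (cases "s * ?m M < 1")
    case True
    have "?q j \<le> n" for j
      using card_mono[of "{..<n}" "{r. r < n \<and> (1 + real r) * (s * ?m j) < 1}"] by auto
    then have "(\<Sum>j<M. ?m j * real (?q j)) \<le> (\<Sum>j<M. ?m j * real n)"
      by (intro sum_mono mult_left_mono) auto
    also have "\<dots> = ?m M - 1"
      by (induction M) (auto simp: algebra_simps)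
    finally have "s * (\<Sum>j<M. ?m j * real (?q j)) \<le> s * (?m M - 1)"
      using assms by simp
    then have "s * (\<Sum>j<M. ?m j * real (?q j)) \<le> 1"
      using True assms by (simp add: algebra_simps)
    moreover have "(s * ?m M) * real (?q M) \<le> 1"
      using assms by (intro card_reciprocals_le) auto
    ultimately show ?thesis by (simp add: algebra_simps)
  next
    case False
    have "(1 + real r) * (s * ?m M) \<ge> 1 * 1" for r
      using False by (intro mult_mono) auto
    then have "?q M = 0" by (simp add: not_less)
    then show ?thesis using Suc by (simp only: sum.lessThan_Suc) simp
  qed
qed simp

text \<open>There is one block of scale \<open>1/m\<^sub>j\<close> for each sign vector \<open>\<sigma>\<^sub>j\<close>. In it, the \<open>k\<close>-th vector is the
  profile \<open>1, 1/2, \<dots>, 1/n\<close>, cyclically shifted by \<open>k\<close> and multiplied by the sign \<open>\<sigma>\<^sub>j(k)\<close>. For given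
  signs \<open>e = \<sigma>\<^sub>j\<close> the products \<open>e(k) \<sigma>\<^sub>j(k)\<close> are 1, so that the signed sum on block \<open>j\<close> equals \<open>H\<^sub>n/m\<^sub>j\<close> on all
  \<open>n m\<^sub>j\<close> points. A weak quasi-norm is large as soon as one level set is, so this block alone gives the lower bound.\<close>

lemma vectors_with_large_signed_sums:
  assumes "n > 0"
  obtains S and a :: "nat \<Rightarrow> nat \<Rightarrow> real" where "S > 0"
    and "\<And>k. weak_norm S (a k) \<le> 2"
    and "\<And>e. (\<And>k. k \<in> {1..n} \<Longrightarrow> e k \<in> {-1, 1}) \<Longrightarrow> real n * harm n \<le> weak_norm S (\<lambda>i. \<Sum>k=1..n. e k * a k i)"
proof -
  let ?E = "PiE {1..n} (\<lambda>_. {-1, 1 :: real})"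
  define M where "M = card ?E"
  have fin: "finite ?E" by (intro finite_PiE) auto
  obtain \<sigma> where \<sigma>: "bij_betw \<sigma> {..<M} ?E"
    using ex_bij_betw_nat_finite[OF fin] unfolding M_def atLeast0LessThan by blast
  define m where "m j = (n + 1) ^ j" for j
  have m_pos: "m j > 0" for j by (simp add: m_def)
  define X where "X = (SIGMA j:{..<M}. {..<m j} \<times> {..<n})"
  define S where "S = card X"
  have finX: "finite X" by (simp add: X_def)
  obtain h where h: "bij_betw h {..<S} X"
    using ex_bij_betw_nat_finite[OF finX] unfolding S_def atLeast0LessThan by blast
  \<comment> \<open>A point is a triple of a block \<open>j\<close>, a copy \<open>c\<close> and a cell \<open>i\<close>. The value 1 outside \<open>{1..n}\<close>
      serves as a sign, so that the bound 2 holds for all \<open>k\<close>.\<close>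
  define b where "b k = (\<lambda>(j, c :: nat, i). (if k \<in> {1..n} then \<sigma> j k else 1) / (real (m j) * (1 + real ((i + k) mod n))))" for k :: nat
  have count: "card {i. i < S \<and> P (h i)} = card {x \<in> X. P x}" for P
  proof (rule bij_betw_same_card)
    show "bij_betw h {i. i < S \<and> P (h i)} {x \<in> X. P x}"
      using h unfolding bij_betw_def by (auto intro: inj_on_subset)
  qed
  have pm: "\<bar>if k \<in> {1..n} then \<sigma> j k else 1\<bar> = 1" if "j < M" for j k
    using bij_betwE[OF \<sigma>] that by (force simp: PiE_iff)
  show thesis
  proof
    have "?E \<noteq> {}" by (simp add: PiE_eq_empty_iff)
    then have "M > 0" unfolding M_def using fin by (simp only: card_gt_0_iff not_False_eq_True simp_thms)
    then have "(0, 0, 0) \<in> X" using assms by (simp add: X_def m_def)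
    then show "S > 0" using finX by (auto simp: S_def card_gt_0_iff)
  next
    fix k
    show "weak_norm S (\<lambda>i. b k (h i)) \<le> 2"
    proof (rule weak_norm_least)
      fix s :: real assume s: "s > 0"
      let ?R = "\<lambda>j. {r. r < n \<and> (1 + real r) * (s * real (m j)) < 1}"
      let ?Q = "\<lambda>j. {i. i < n \<and> (i + k) mod n \<in> ?R j}"
      have eq: "s < \<bar>b k (j, c, i)\<bar> \<longleftrightarrow> (1 + real ((i + k) mod n)) * (s * real (m j)) < 1"
        if "j < M" for j c i
      proof -
        have "real (m j) * (1 + real ((i + k) mod n)) > 0"
          using m_pos[of j] by (simp add: add_pos_nonneg)
        moreover from this have "\<bar>b k (j, c, i)\<bar> = 1 / (real (m j) * (1 + real ((i + k) mod n)))"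
          using pm[OF that, of k] by (simp only: b_def prod.case abs_divide abs_of_pos)
        ultimately show ?thesis by (simp only: pos_less_divide_eq mult_ac)
      qed
      have "{x \<in> X. s < \<bar>b k x\<bar>} = (SIGMA j:{..<M}. {..<m j} \<times> ?Q j)"
        using eq assms by (fastforce simp: X_def)
      moreover have "card (?Q j) = card (?R j)" for j
      proof (rule bij_betw_same_card)
        show "bij_betw (\<lambda>i. (i + k) mod n) (?Q j) (?R j)"
        proof -
          have "inj_on (\<lambda>i. (i + k) mod n) (?Q j)"
            using cyclic_shift_bij[of k n] unfolding bij_betw_def by (auto intro: inj_on_subset)
          moreover have "(\<lambda>i. (i + k) mod n) ` ?Q j = ?R j"
          proof (intro equalityI subsetI)
            fix r assume r: "r \<in> ?R j"
            then have "r \<in> (\<lambda>i. (i + k) mod n) ` {..<n}"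
              using cyclic_shift_bij[of k n] by (simp add: bij_betw_def)
            then show "r \<in> (\<lambda>i. (i + k) mod n) ` ?Q j" using r by blast
          qed blast
          ultimately show ?thesis by (simp add: bij_betw_def)
        qed
      qed
      ultimately have "card {i. i < S \<and> s < \<bar>b k (h i)\<bar>} = (\<Sum>j<M. m j * card (?R j))"
        by (simp add: count[of "\<lambda>x. s < \<bar>b k x\<bar>"] card_cartesian_product)
      then have "s * real (card {i. i < S \<and> s < \<bar>b k (h i)\<bar>}) =
        s * (\<Sum>j<M. (real n + 1) ^ j * real (card {r. r < n \<and> (1 + real r) * (s * (real n + 1) ^ j) < 1}))"
        by (simp add: m_def add.commute)
      also have "\<dots> \<le> 2" by (rule card_superlevel_scaled_blocks[OF s])
      finally show "s * real (card {i. i < S \<and> s < \<bar>b k (h i)\<bar>}) \<le> 2" .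
    qed
  next
    fix e assume e: "\<And>k. k \<in> {1..n} \<Longrightarrow> e k \<in> {-1, 1 :: real}"
    then have "restrict e {1..n} \<in> ?E" by auto
    then obtain j where j: "j < M" "\<sigma> j = restrict e {1..n}"
      using \<sigma> unfolding bij_betw_def by (metis imageE lessThan_iff)
    let ?f = "\<lambda>x. \<Sum>k=1..n. e k * b k x"
    have val: "?f (j, c, i) = harm n / real (m j)" for c i
    proof -
      have "e k * b k (j, c, i) = 1 / (1 + real ((i + k) mod n)) / real (m j)" if "k \<in> {1..n}" for k
        using e[OF that] j that by (auto simp: b_def)
      then have "?f (j, c, i) = (\<Sum>k=1..n. 1 / (1 + real ((i + k) mod n)) / real (m j))"
        by (intro sum.cong) auto
      then show ?thesis by (simp only: sum_divide_distrib[symmetric] sum_cyclic_reciprocals)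
    qed
    have hp: "harm n > (0::real)" using assms by (simp add: harm_pos_iff)
    show "real n * harm n \<le> weak_norm S (\<lambda>i. ?f (h i))"
    proof (rule field_le_mult_one_interval)
      fix z :: real assume z: "0 < z" "z < 1"
      \<comment> \<open>Superlevel sets are strict, so the level \<open>H\<^sub>n/m\<^sub>j\<close> is approached from below.\<close>
      define s where "s = z * (harm n / real (m j))"
      have s: "s > 0" "s < harm n / real (m j)"
        using z hp m_pos[of j] by (auto simp: s_def divide_simps)
      have "{j} \<times> {..<m j} \<times> {..<n} \<subseteq> {x \<in> X. s < \<bar>?f x\<bar>}"
        using s j val by (fastforce simp: X_def)
      from card_mono[OF _ this] finX have "m j * n \<le> card {i. i < S \<and> s < \<bar>?f (h i)\<bar>}"
        unfolding count[of "\<lambda>x. s < \<bar>?f x\<bar>"] by simp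
      then have "s * real (m j * n) \<le> s * real (card {i. i < S \<and> s < \<bar>?f (h i)\<bar>})"
        using s by (intro mult_left_mono of_nat_mono) simp_all
      also have "\<dots> \<le> weak_norm S (\<lambda>i. ?f (h i))" by (rule weak_norm_upper) fact
      finally show "z * (real n * harm n) \<le> weak_norm S (\<lambda>i. ?f (h i))"
        using m_pos[of j] by (simp add: s_def mult_ac)
    qed
  qed
qed

section \<open>Spaces containing finite weak \<open>\<ell>\<^sub>1\<close> sections\<close>

text \<open>The factor \<open>\<delta>\<close> is the cell length when sequences are realised as step functions. Linearity
  is spelled out, since \<open>nat \<Rightarrow> real\<close> is not an instance of the class of real vector spaces.\<close>

definition scaled_copy :: "'v::real_vector set \<Rightarrow> ('v \<Rightarrow> real) \<Rightarrow> nat \<Rightarrow> real \<Rightarrow> ((nat \<Rightarrow> real) \<Rightarrow> 'v) \<Rightarrow> bool" where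
  "scaled_copy V N S \<delta> T \<longleftrightarrow>
     (\<forall>a b. T (\<lambda>i. a i + b i) = T a + T b) \<and> (\<forall>c a. T (\<lambda>i. c * a i) = c *\<^sub>R T a) \<and>
     (\<forall>a. T a \<in> V \<and> N (T a) = \<delta> * weak_norm S a)"

definition has_weak_l1_copies :: "'v::real_vector set \<Rightarrow> ('v \<Rightarrow> real) \<Rightarrow> bool" where
  "has_weak_l1_copies V N \<longleftrightarrow> (\<forall>S>0. \<exists>\<delta>>0. \<exists>T. scaled_copy V N S \<delta> T)"

text \<open>The common core of both negative results. The lower bound \<open>L\<close> holds for all signs at once, so it
  bounds a Rademacher average as well as the plain sum. The triangle inequality of a norm on \<open>V\<close>
  is available only for vectors of \<open>V\<close>; the subspace \<open>W\<close> ensures that all partial sums lie there.\<close>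

lemma uniformly_large_signed_sums:
  fixes V :: "'v::real_vector set"
  assumes "has_weak_l1_copies V N"
  shows "\<exists>n W L. \<exists>x :: nat \<Rightarrow> 'v. subspace W \<and> W \<subseteq> V \<and> (\<forall>k. x k \<in> W) \<and>
    K * (\<Sum>k=1..n. N (x k)) < L \<and>
    (\<forall>e. (\<forall>k\<in>{1..n}. e k \<in> {-1, 1}) \<longrightarrow> L \<le> N (\<Sum>k=1..n. e k *\<^sub>R x k))"
proof -
  have "eventually (\<lambda>n. harm n > 2 * \<bar>K\<bar> \<and> n > 0) sequentially"
    using harm_at_top eventually_gt_at_top[of "0::nat"]
    by (auto simp: filterlim_at_top_dense eventually_conj_iff)
  then obtain n where n: "harm n > 2 * \<bar>K\<bar>" "n > 0"
    using eventually_happens by force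
  obtain S a where S: "S > 0" and a: "\<And>k. weak_norm S (a k) \<le> 2"
    and big: "\<And>e. (\<And>k. k \<in> {1..n} \<Longrightarrow> e k \<in> {-1, 1}) \<Longrightarrow> real n * harm n \<le> weak_norm S (\<lambda>i. \<Sum>k=1..n. e k * a k i)"
    using vectors_with_large_signed_sums[OF n(2)] by blast
  from assms S obtain \<delta> T where \<delta>: "\<delta> > 0" and T: "scaled_copy V N S \<delta> T"
    unfolding has_weak_l1_copies_def by blast
  have add: "T (\<lambda>i. a i + b i) = T a + T b"
    and scale: "T (\<lambda>i. c * a i) = c *\<^sub>R T a"
    and V: "T a \<in> V" and N: "N (T a) = \<delta> * weak_norm S a" for a b c
    using T unfolding scaled_copy_def by simp_all
  have zero: "T (\<lambda>i. 0) = 0"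
    using scale[of 0 "\<lambda>_. 0"] by simp
  have lin: "T (\<lambda>i. \<Sum>k\<in>F. e k * a k i) = (\<Sum>k\<in>F. e k *\<^sub>R T (a k))" if "finite F" for F e
    using that by induction (simp_all add: zero add scale)
  have range_T: "T a + T b \<in> range T" "c *\<^sub>R T a \<in> range T" "0 \<in> range T" for a b c
    by (simp_all only: add[symmetric] scale[symmetric] zero[symmetric] rangeI)
  show ?thesis
  proof (rule exI[of _ n], rule exI[of _ "range T"], rule exI[of _ "\<delta> * (real n * harm n)"],
      rule exI[of _ "\<lambda>k. T (a k)"], intro conjI)
    show "subspace (range T)"
      unfolding subspace_def using range_T by blast
  next
    have "K * (\<Sum>k=1..n. N (T (a k))) \<le> \<bar>K\<bar> * (\<Sum>k=1..n. \<delta> * 2)"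
      using \<delta> a by (intro mult_mono sum_mono sum_nonneg) (auto simp: N weak_norm_nonneg)
    also have "\<dots> = \<delta> * (real n * (2 * \<bar>K\<bar>))" by simp
    also have "\<dots> < \<delta> * (real n * harm n)"
      using n \<delta> by simp
    finally show "K * (\<Sum>k=1..n. N (T (a k))) < \<delta> * (real n * harm n)" .
  next
    show "\<forall>e. (\<forall>k\<in>{1..n}. e k \<in> {-1, 1}) \<longrightarrow> \<delta> * (real n * harm n) \<le> N (\<Sum>k=1..n. e k *\<^sub>R T (a k))"
    proof (intro allI impI)
      fix e assume e: "\<forall>k\<in>{1..n}. e k \<in> {-1, 1 :: real}"
      have "\<delta> * (real n * harm n) \<le> \<delta> * weak_norm S (\<lambda>i. \<Sum>k=1..n. e k * a k i)"
        using big[of e] e \<delta> by simp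
      also have "\<dots> = N (\<Sum>k=1..n. e k *\<^sub>R T (a k))"
        by (simp only: N[symmetric] lin finite_atLeastAtMost)
      finally show "\<delta> * (real n * harm n) \<le> N (\<Sum>k=1..n. e k *\<^sub>R T (a k))" .
    qed
  qed (use V in auto)
qed

text \<open>With all signs equal to 1, an equivalent norm would bound the quasi-norm of the sum by a fixed
  multiple of the sum of the quasi-norms.\<close>

lemma copies_imp_not_normable:
  assumes "has_weak_l1_copies V N"
  shows "\<not> normable V N"
proof
  assume "normable V N"
  then obtain p c C where p: "is_norm_on V p" and c: "c > 0" "C > 0"
    and eqv: "\<And>x. x \<in> V \<Longrightarrow> c * N x \<le> p x \<and> p x \<le> C * N x"
    unfolding normable_def by blast
  obtain n :: nat and W L x where W: "subspace W" "W \<subseteq> V" and x: "\<forall>k. x k \<in> W"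
    and big: "C / c * (\<Sum>k=1..n. N (x k)) < L"
      "\<forall>e. (\<forall>k\<in>{1..n}. e k \<in> {-1, 1}) \<longrightarrow> L \<le> N (\<Sum>k=1..n. e k *\<^sub>R x k)"
    using uniformly_large_signed_sums[OF assms, of "C / c"] by (elim exE conjE) (rule that; assumption)
  have p0: "p 0 = 0"
    using p W subspace_0[OF W(1)] by (auto simp: is_norm_on_def)
  have psum: "p (\<Sum>k\<in>F. x k) \<le> (\<Sum>k\<in>F. p (x k))" if "finite F" for F
    using that
  proof induction
    case (insert k F)
    have "p (x k + (\<Sum>k\<in>F. x k)) \<le> p (x k) + p (\<Sum>k\<in>F. x k)"
      using p W(2) x subspace_sum[OF W(1), of F x] unfolding is_norm_on_def by (meson subsetD)
    with insert show ?case by simp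
  qed (simp add: p0)
  have "c * N (\<Sum>k=1..n. x k) \<le> p (\<Sum>k=1..n. x k)"
    using eqv W x subspace_sum[OF W(1), of _ x] by blast
  also have "\<dots> \<le> (\<Sum>k=1..n. p (x k))" by (rule psum) simp
  also have "\<dots> \<le> C * (\<Sum>k=1..n. N (x k))"
    unfolding sum_distrib_left using eqv W x by (intro sum_mono) blast
  finally have "N (\<Sum>k=1..n. x k) \<le> C / c * (\<Sum>k=1..n. N (x k))"
    using c by (simp add: field_simps)
  then show False
    using big(1) big(2)[rule_format, of "\<lambda>_. 1"] by simp
qed

text \<open>The zeros of the Rademacher functions are dyadic rationals.\<close>

lemma rademacher_pm1:
  assumes "t \<notin> \<rat>"
  shows "rademacher k t \<in> {-1, 1}"
proof -
  have "sin (2 ^ k * pi * t) \<noteq> 0"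
  proof
    assume "sin (2 ^ k * pi * t) = 0"
    then obtain i :: int where "2 ^ k * pi * t = of_int i * pi"
      unfolding sin_zero_iff_int2 by blast
    then have "t = of_int i / 2 ^ k" by (simp add: field_simps)
    then show False using assms by auto
  qed
  then show ?thesis by (auto simp: rademacher_def sgn_real_def)
qed

text \<open>A Bochner integral is 0 for functions that are not integrable, so a lower bound for a Rademacher
  average needs integrability. It holds for every \<open>\<Phi>\<close>, however irregular, because the sign vector takes
  only finitely many values.\<close>

lemma rademacher_function_integrable:
  fixes \<Phi> :: "(nat \<Rightarrow> real) \<Rightarrow> real"
  assumes "finite F"
  shows "set_integrable lborel {0..1} (\<lambda>t. \<Phi> (\<lambda>k\<in>F. rademacher k t))"
proof -
  let ?P = "PiE F (\<lambda>_. {-1, 0, 1 :: real})"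
  have fin: "finite ?P" using assms by (intro finite_PiE) auto
  have mem: "(\<lambda>k\<in>F. rademacher k t) \<in> ?P" for t
    by (auto simp: rademacher_def sgn_real_def)
  have "(\<lambda>t. \<lambda>k\<in>F. rademacher k t) \<in> measurable lborel (count_space ?P)"
  proof (rule measurable_count_space_eq2[THEN iffD2, OF fin], intro conjI ballI)
    fix v assume v: "v \<in> ?P"
    have "(\<lambda>t. \<lambda>k\<in>F. rademacher k t) -` {v} = {t. \<forall>k\<in>F. rademacher k t = v k}"
      using v by (auto simp: fun_eq_iff PiE_def extensional_def)
    moreover have "rademacher k \<in> borel_measurable borel" for k
      unfolding rademacher_def sgn_real_def by measurable
    then have "{t. \<forall>k\<in>F. rademacher k t = v k} \<in> sets borel"
      using assms by measurable
    ultimately show "(\<lambda>t. \<lambda>k\<in>F. rademacher k t) -` {v} \<inter> space lborel \<in> sets lborel"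
      by simp
  qed (use mem in auto)
  then have meas: "(\<lambda>t. \<Phi> (\<lambda>k\<in>F. rademacher k t)) \<in> borel_measurable lborel"
    by (rule measurable_compose) simp
  have "\<bar>\<Phi> (\<lambda>k\<in>F. rademacher k t)\<bar> \<le> (\<Sum>v\<in>?P. \<bar>\<Phi> v\<bar>)" for t
    using member_le_sum[where f = "\<lambda>v. \<bar>\<Phi> v\<bar>", OF mem] fin by simp
  with meas show ?thesis
    unfolding set_integrable_def
    by (intro integrableI_bounded_set_indicator[where B = "\<Sum>v\<in>?P. \<bar>\<Phi> v\<bar>"]) auto
qed

text \<open>For almost every \<open>t\<close> the Rademacher functions form a vector of signs, so the average is at least \<open>L\<close>.\<close>

lemma copies_imp_not_type_one:
  assumes "has_weak_l1_copies V N"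
  shows "\<not> has_type_one V N"
proof
  assume "has_type_one V N"
  then obtain K where K: "\<And>n x. (\<forall>k\<in>{1..n}. x k \<in> V) \<Longrightarrow>
        (LINT t:{0..1}|lborel. N (\<Sum>k=1..n. rademacher k t *\<^sub>R x k)) \<le> K * (\<Sum>k=1..n. N (x k))"
    unfolding has_type_one_def by blast
  obtain n :: nat and W L x where W: "subspace W" "W \<subseteq> V" and x: "\<forall>k. x k \<in> W"
    and big: "K * (\<Sum>k=1..n. N (x k)) < L"
      "\<forall>e. (\<forall>k\<in>{1..n}. e k \<in> {-1, 1}) \<longrightarrow> L \<le> N (\<Sum>k=1..n. e k *\<^sub>R x k)"
    using uniformly_large_signed_sums[OF assms, of K] by (elim exE conjE) (rule that; assumption)
  have "set_integrable lborel {0..1} (\<lambda>t. N (\<Sum>k=1..n. (\<lambda>k\<in>{1..n}. rademacher k t) k *\<^sub>R x k))"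
    by (rule rademacher_function_integrable) simp
  then have int: "set_integrable lborel {0..1} (\<lambda>t. N (\<Sum>k=1..n. rademacher k t *\<^sub>R x k))"
    by (simp only: restrict_apply' cong: sum.cong)
  have irrational: "AE t in lborel. t \<notin> (\<rat> :: real set)"
    by (rule AE_not_in[OF countable_imp_null_set_lborel[OF countable_rat]])
  have "L = (LINT t:{0..1::real}|lborel. L)"
    by (simp add: set_lebesgue_integral_def)
  also have "\<dots> \<le> (LINT t:{0..1}|lborel. N (\<Sum>k=1..n. rademacher k t *\<^sub>R x k))"
    unfolding set_lebesgue_integral_def
  proof (rule integral_mono_AE)
    show "AE t in lborel. indicator {0..1} t *\<^sub>R L \<le>
        indicator {0..1} t *\<^sub>R N (\<Sum>k=1..n. rademacher k t *\<^sub>R x k)"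
      using irrational
    proof eventually_elim
      case (elim t)
      then have "L \<le> N (\<Sum>k=1..n. rademacher k t *\<^sub>R x k)"
        by (intro big(2)[rule_format] rademacher_pm1)
      then show ?case by (simp add: indicator_def)
    qed
  qed (use int in \<open>auto simp: set_integrable_def\<close>)
  also have "\<dots> \<le> K * (\<Sum>k=1..n. N (x k))"
    using K W x by blast
  finally show False using big(1) by simp
qed

section \<open>Step functions and finite sequences\<close>

definition grid_fun :: "real \<Rightarrow> nat \<Rightarrow> (nat \<Rightarrow> real) \<Rightarrow> real \<Rightarrow> real" where
  "grid_fun \<delta> S a t = (\<Sum>i<S. a i * indicator {\<delta> * real i..<\<delta> * (real i + 1)} t)"

lemma grid_cell_unique:
  assumes "\<delta> > 0" "t \<in> {\<delta> * real i..<\<delta> * (real i + 1)}" "t \<in> {\<delta> * real j..<\<delta> * (real j + 1)}"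
  shows "i = j"
proof -
  have "\<delta> * real i < \<delta> * (real j + 1)" "\<delta> * real j < \<delta> * (real i + 1)"
    using assms(2,3) by auto
  then have "real i < real j + 1" "real j < real i + 1"
    using assms(1) by auto
  then show ?thesis by linarith
qed

lemma grid_fun_on_cell:
  assumes "\<delta> > 0" "i < S" "t \<in> {\<delta> * real i..<\<delta> * (real i + 1)}"
  shows "grid_fun \<delta> S a t = a i"
proof -
  have "grid_fun \<delta> S a t = (\<Sum>j<S. if j = i then a i else 0)"
    unfolding grid_fun_def
  proof (rule sum.cong[OF refl])
    fix j
    show "a j * indicator {\<delta> * real j..<\<delta> * (real j + 1)} t = (if j = i then a i else 0)"
      using grid_cell_unique[OF assms(1,3), of j] assms(3) by (cases "j = i") (auto simp: indicator_def)
  qed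
  then show ?thesis using assms(2) by simp
qed

lemma grid_fun_off_cells:
  assumes "\<And>i. i < S \<Longrightarrow> t \<notin> {\<delta> * real i..<\<delta> * (real i + 1)}"
  shows "grid_fun \<delta> S a t = 0"
  unfolding grid_fun_def using assms by (intro sum.neutral) (auto simp: indicator_def)

lemma grid_fun_outside:
  assumes "\<delta> > 0" "t < 0 \<or> t \<ge> \<delta> * real S"
  shows "grid_fun \<delta> S a t = 0"
proof (rule grid_fun_off_cells)
  fix i assume "i < S"
  then have "\<delta> * (real i + 1) \<le> \<delta> * real S" using assms(1) by simp
  moreover have "0 \<le> \<delta> * real i" using assms(1) by simp
  ultimately show "t \<notin> {\<delta> * real i..<\<delta> * (real i + 1)}" using assms(2) by auto
qed

lemma distribution_grid_fun:
  assumes \<delta>: "\<delta> > 0" and s: "s \<ge> 0"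
    and I: "AE t in lebesgue. t \<in> {0..<\<delta> * real S} \<longrightarrow> t \<in> I"
  shows "distribution I (grid_fun \<delta> S a) s = ennreal (\<delta> * real (card {i. i < S \<and> s < \<bar>a i\<bar>}))"
proof -
  let ?A = "{i. i < S \<and> s < \<bar>a i\<bar>}"
  let ?J = "\<lambda>i. {\<delta> * real i..<\<delta> * (real i + 1)}"
  have eq: "s < \<bar>grid_fun \<delta> S a t\<bar> \<longleftrightarrow> t \<in> (\<Union>i\<in>?A. ?J i)" for t
  proof (cases "\<exists>i<S. t \<in> ?J i")
    case True
    then obtain i where i: "i < S" "t \<in> ?J i" by blast
    have "t \<in> (\<Union>i\<in>?A. ?J i) \<longleftrightarrow> i \<in> ?A"
      using grid_cell_unique[OF \<delta> i(2)] i(2) by blast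
    then show ?thesis
      using grid_fun_on_cell[OF \<delta> i, of a] i(1) by simp
  next
    case False
    then have "grid_fun \<delta> S a t = 0" by (intro grid_fun_off_cells) blast
    moreover have "t \<notin> (\<Union>i\<in>?A. ?J i)" using False by blast
    ultimately show ?thesis using s by simp
  qed
  have supp: "t \<in> {0..<\<delta> * real S}" if "s < \<bar>grid_fun \<delta> S a t\<bar>" for t
    using grid_fun_outside[OF \<delta>, of t S a] that s by force
  have "AE t in lebesgue. t \<in> {t \<in> I. s < \<bar>grid_fun \<delta> S a t\<bar>} \<longleftrightarrow> t \<in> (\<Union>i\<in>?A. ?J i)"
    using I by eventually_elim (use eq supp in blast)
  then have "distribution I (grid_fun \<delta> S a) s = emeasure lebesgue (\<Union>i\<in>?A. ?J i)"
    unfolding distribution_def by (rule emeasure_lebesgue_cong_AE)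
  also have "\<dots> = (\<Sum>i\<in>?A. emeasure lebesgue (?J i))"
  proof (rule sum_emeasure[symmetric])
    show "disjoint_family_on ?J ?A"
      unfolding disjoint_family_on_def using grid_cell_unique[OF \<delta>] by blast
  qed auto
  also have "\<dots> = (\<Sum>i\<in>?A. ennreal \<delta>)"
    using \<delta> by (intro sum.cong) (auto simp: algebra_simps)
  also have "\<dots> = ennreal (\<delta> * real (card ?A))"
    using \<delta> by (simp add: ennreal_mult ennreal_of_nat_eq_real_of_nat mult.commute)
  finally show ?thesis .
qed

lemma rearrangement_le:
  "s > 0 \<Longrightarrow> distribution I f s \<le> ennreal t \<Longrightarrow> rearrangement I f t \<le> ennreal s"
  unfolding rearrangement_def by (rule INF_lower) simp

lemma rearrangement_ge:
  assumes "\<And>u. 0 < u \<Longrightarrow> u < s \<Longrightarrow> ennreal t < distribution I f u"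
  shows "ennreal s \<le> rearrangement I f t"
  unfolding rearrangement_def
proof (rule INF_greatest)
  fix u assume "u \<in> {u. u > 0 \<and> distribution I f u \<le> ennreal t}"
  then have "\<not> u < s" using assms[of u] by force
  then show "ennreal s \<le> ennreal u" by (simp add: ennreal_leI)
qed

text \<open>The two parameters cover both spaces: \<open>t' = t\<close> for functions, and \<open>t' = i + 1\<close>, \<open>t = i\<close> for
  sequences, where the distribution function is integer-valued and hence at most \<open>i\<close> as soon as it is
  less than \<open>i + 1\<close>.\<close>

lemma rearrangement_times_le_weak_norm:
  assumes "\<delta> > 0" "t' > 0"
    and d: "\<And>u. u > 0 \<Longrightarrow> \<delta> * real (card {i. i < S \<and> u < \<bar>a i\<bar>}) < t' \<Longrightarrow> distribution I f u \<le> ennreal t"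
  shows "ennreal t' * rearrangement I f t \<le> ennreal (\<delta> * weak_norm S a)"
proof (rule ennreal_le_epsilon)
  fix e :: real assume e: "e > 0"
  \<comment> \<open>Without the slack \<open>e\<close> the level \<open>u\<close> could be 0, and the strict inequality below would fail.\<close>
  define u where "u = (\<delta> * weak_norm S a + e) / t'"
  have nn: "\<delta> * weak_norm S a \<ge> 0" using assms(1) weak_norm_nonneg by simp
  then have u: "u > 0" using e assms(2) by (simp add: u_def)
  have "u * (\<delta> * real (card {i. i < S \<and> u < \<bar>a i\<bar>})) \<le> \<delta> * weak_norm S a"
    using mult_left_mono[OF weak_norm_upper[OF u, of S a], of \<delta>] assms(1) by (simp add: mult_ac)
  also have "\<dots> < u * t'" using e assms(2) by (simp add: u_def)
  finally have "\<delta> * real (card {i. i < S \<and> u < \<bar>a i\<bar>}) < t'" using u by simp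
  then have "rearrangement I f t \<le> ennreal u"
    by (intro rearrangement_le d u)
  then have "ennreal t' * rearrangement I f t \<le> ennreal t' * ennreal u"
    by (rule mult_left_mono) simp
  also have "\<dots> = ennreal (\<delta> * weak_norm S a) + ennreal e"
    using assms(2) e nn u by (simp add: u_def ennreal_mult[symmetric] ennreal_plus[symmetric] del: ennreal_plus)
  finally show "ennreal t' * rearrangement I f t \<le> ennreal (\<delta> * weak_norm S a) + ennreal e" .
qed

lemma card_superlevel_antimono:
  fixes S :: nat and a :: "nat \<Rightarrow> real"
  assumes "u \<le> s"
  shows "card {i. i < S \<and> s < \<bar>a i\<bar>} \<le> card {i. i < S \<and> u < \<bar>a i\<bar>}"
  using assms by (intro card_mono) auto

text \<open>The supremum over \<open>t\<close> of \<open>t f\<^sup>*(t)\<close> equals the supremum over \<open>s\<close> of \<open>s d(s)\<close>: as \<open>t\<close> increases to \<open>d(s)\<close>,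
  the rearrangement stays at least \<open>s\<close>. The cells have to fit into \<open>I\<close> for \<open>t\<close> to be admissible.\<close>

lemma weak_L1_enorm_grid_fun:
  assumes \<delta>: "\<delta> > 0" and I: "{0<..<\<delta> * real S} \<subseteq> I" "I \<subseteq> {0<..}"
  shows "(SUP t\<in>I. ennreal t * rearrangement I (grid_fun \<delta> S a) t) = ennreal (\<delta> * weak_norm S a)"
    (is "?N = _")
proof (rule antisym)
  let ?c = "\<lambda>s. card {i. i < S \<and> s < \<bar>a i\<bar>}"
  have "AE t in lebesgue. t \<noteq> (0 :: real)"
    by (rule AE_completion) (rule AE_lborel_singleton)
  then have "AE t in lebesgue. t \<in> {0..<\<delta> * real S} \<longrightarrow> t \<in> I"
    by eventually_elim (use I(1) in auto)
  then have d: "distribution I (grid_fun \<delta> S a) u = ennreal (\<delta> * real (?c u))" if "u > 0" for u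
    using distribution_grid_fun \<delta> that by simp
  show le: "?N \<le> ennreal (\<delta> * weak_norm S a)"
  proof (rule SUP_least)
    fix t assume "t \<in> I"
    then have "t > 0" using I(2) by auto
    then show "ennreal t * rearrangement I (grid_fun \<delta> S a) t \<le> ennreal (\<delta> * weak_norm S a)"
      by (intro rearrangement_times_le_weak_norm[OF \<delta>]) (auto simp: d intro: ennreal_leI)
  qed
  obtain r where r: "?N = ennreal r" "r \<ge> 0"
    using le by (cases ?N) (auto simp: top_unique)
  have "weak_norm S a \<le> r / \<delta>"
  proof (rule weak_norm_least)
    fix s :: real assume s: "s > 0"
    have "s * (\<delta> * real (?c s)) \<le> r"
    proof (rule field_le_mult_one_interval)
      fix z :: real assume z: "0 < z" "z < 1"
      define t where "t = z * (\<delta> * real (?c s))"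
      show "z * (s * (\<delta> * real (?c s))) \<le> r"
      proof (cases "?c s = 0")
        case True
        show ?thesis unfolding True using r(2) by simp
      next
        case False
        have "?c s \<le> S" using card_mono[of "{..<S}" "{i. i < S \<and> s < \<bar>a i\<bar>}"] by auto
        then have "\<delta> * real (?c s) \<le> \<delta> * real S" using \<delta> by simp
        moreover have "\<delta> * real (?c s) > 0"
          by (intro mult_pos_pos \<delta>) (simp only: of_nat_0_less_iff neq0_conv[symmetric] False not_False_eq_True)
        then have t: "0 < t" "t < \<delta> * real (?c s)"
          using mult_strict_right_mono[OF z(2)] z(1) unfolding t_def
          by (simp_all only: mult_pos_pos mult_1)
        ultimately have "t \<in> I" using I(1) by auto
        have "ennreal s \<le> rearrangement I (grid_fun \<delta> S a) t"
        proof (rule rearrangement_ge)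
          fix u assume u: "0 < u" "u < s"
          have "t < \<delta> * real (?c s)" by fact
          also have "\<dots> \<le> \<delta> * real (?c u)"
            using card_superlevel_antimono[of u s S a] u \<delta> by simp
          finally show "ennreal t < distribution I (grid_fun \<delta> S a) u"
            using d[OF u(1)] t(1) by (simp add: ennreal_lessI)
        qed
        then have "ennreal t * ennreal s \<le> ennreal t * rearrangement I (grid_fun \<delta> S a) t"
          by (rule mult_left_mono) simp
        also have "\<dots> \<le> ?N" using \<open>t \<in> I\<close> by (rule SUP_upper)
        finally have "t * s \<le> r" using r t s by (simp add: ennreal_mult[symmetric])
        then show ?thesis by (simp add: t_def mult_ac)
      qed
    qed
    then show "s * real (?c s) \<le> r / \<delta>" using \<delta> by (simp add: field_simps)
  qed
  then show "ennreal (\<delta> * weak_norm S a) \<le> ?N"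
    unfolding r using \<delta> by (intro ennreal_leI) (simp add: field_simps)
qed

lemma grid_fun_measurable: "grid_fun \<delta> S a \<in> borel_measurable lebesgue"
proof -
  have "grid_fun \<delta> S a \<in> borel_measurable borel"
    unfolding grid_fun_def by measurable
  then show ?thesis
    by (simp add: measurable_completion)
qed

lemma grid_fun_add: "grid_fun \<delta> S (\<lambda>i. a i + b i) t = grid_fun \<delta> S a t + grid_fun \<delta> S b t"
  by (simp add: grid_fun_def distrib_right sum.distrib)

lemma grid_fun_scale: "grid_fun \<delta> S (\<lambda>i. c * a i) t = c * grid_fun \<delta> S a t"
  by (simp only: grid_fun_def sum_distrib_left mult.assoc)

lift_definition grid_L0 :: "real \<Rightarrow> nat \<Rightarrow> (nat \<Rightarrow> real) \<Rightarrow> L0" is grid_fun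
  by (simp add: grid_fun_measurable)

text \<open>Since \<open>S\<close> cells of length \<open>1/S\<close> fill the unit interval, the same step functions serve for both
  choices of \<open>I\<close>.\<close>

lemma weak_L1_has_copies:
  assumes "I = {0<..<1} \<or> I = {0<..}"
  shows "has_weak_l1_copies (weak_L1 I) (weak_L1_norm I)"
  unfolding has_weak_l1_copies_def
proof (intro allI impI)
  fix S :: nat assume S: "S > 0"
  define \<delta> where "\<delta> = 1 / real S"
  have \<delta>: "\<delta> > 0" "\<delta> * real S = 1" using S by (auto simp: \<delta>_def)
  have I: "{0<..<\<delta> * real S} \<subseteq> I" "I \<subseteq> {0<..}" using assms \<delta> by auto
  have add: "grid_L0 \<delta> S (\<lambda>i. a i + b i) = grid_L0 \<delta> S a + grid_L0 \<delta> S b" for a b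
    by (transfer fixing: a b \<delta> S) (simp add: grid_fun_add grid_fun_measurable borel_measurable_add)
  have scale: "grid_L0 \<delta> S (\<lambda>i. c * a i) = c *\<^sub>R grid_L0 \<delta> S a" for c a
    by (transfer fixing: a c \<delta> S) (simp add: grid_fun_scale grid_fun_measurable borel_measurable_times)
  have norm: "weak_L1_enorm I (grid_L0 \<delta> S a) = ennreal (\<delta> * weak_norm S a)" for a
    by (transfer fixing: a \<delta> S I) (rule weak_L1_enorm_grid_fun[OF \<delta>(1) I])
  have "vanishes_off I (grid_L0 \<delta> S a)" for a
  proof -
    have "AE t in lebesgue. t \<noteq> (0 :: real)"
      by (rule AE_completion) (rule AE_lborel_singleton)
    then have ae: "AE t in lebesgue. t \<notin> I \<longrightarrow> grid_fun \<delta> S a t = 0"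
    proof eventually_elim
      case (elim t)
      show ?case
      proof
        assume "t \<notin> I"
        then have "t \<notin> {0<..<\<delta> * real S}" using I(1) by blast
        with elim show "grid_fun \<delta> S a t = 0"
          by (intro grid_fun_outside[OF \<delta>(1)]) auto
      qed
    qed
    show ?thesis by (transfer fixing: a \<delta> S I) (rule ae)
  qed
  then show "\<exists>\<delta>>0. \<exists>T. scaled_copy (weak_L1 I) (weak_L1_norm I) S \<delta> T"
    using \<delta>(1) add scale norm weak_norm_nonneg
    by (intro exI[of _ \<delta>] conjI exI[of _ "grid_L0 \<delta> S"]) (auto simp: scaled_copy_def weak_L1_def weak_L1_norm_def)
qed

lemma step_fun_finite_support:
  assumes "\<And>i. apply_bcontfun x i = (if i < S then a i else 0)"
  shows "step_fun x = grid_fun 1 S a"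
proof
  fix t
  have "step_fun x t = (\<Sum>i<S. apply_bcontfun x i * indicator {real i..<real i + 1} t)"
    unfolding step_fun_def by (rule suminf_finite) (auto simp: assms)
  then show "step_fun x t = grid_fun 1 S a t"
    by (simp add: grid_fun_def assms)
qed

lemma weak_l1_enorm_finite_support:
  assumes "\<And>i. apply_bcontfun x i = (if i < S then a i else 0)"
  shows "weak_l1_enorm x = ennreal (weak_norm S a)"
proof (rule antisym)
  let ?c = "\<lambda>s. card {i. i < S \<and> s < \<bar>a i\<bar>}"
  have d: "distribution {0..} (step_fun x) u = of_nat (?c u)" if "u > 0" for u
    using distribution_grid_fun[of 1 u S "{0..}" a] that
    by (simp add: step_fun_finite_support[OF assms] ennreal_of_nat_eq_real_of_nat)
  show le: "weak_l1_enorm x \<le> ennreal (weak_norm S a)"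
    unfolding weak_l1_enorm_def
  proof (rule SUP_least)
    fix i
    have "ennreal (real (i + 1)) * rearrangement {0..} (step_fun x) (real i) \<le> ennreal (1 * weak_norm S a)"
      by (rule rearrangement_times_le_weak_norm) (auto simp: d ennreal_of_nat_eq_real_of_nat[symmetric])
    then show "of_nat (i + 1) * rearrangement {0..} (step_fun x) (real i) \<le> ennreal (weak_norm S a)"
      by (simp only: ennreal_of_nat_eq_real_of_nat mult_1)
  qed
  obtain r where r: "weak_l1_enorm x = ennreal r" "r \<ge> 0"
    using le by (cases "weak_l1_enorm x") (auto simp: top_unique)
  have "weak_norm S a \<le> r"
  proof (rule weak_norm_least)
    fix s :: real assume s: "s > 0"
    show "s * real (?c s) \<le> r"
    proof (cases "?c s")
      case 0
      show ?thesis unfolding 0 using r(2) by simp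
    next
      case (Suc i)
      have "ennreal s \<le> rearrangement {0..} (step_fun x) (real i)"
      proof (rule rearrangement_ge)
        fix u assume u: "0 < u" "u < s"
        then have "i < ?c u"
          using card_superlevel_antimono[of u s S a] Suc by simp
        then show "ennreal (real i) < distribution {0..} (step_fun x) u"
          using d[OF u(1)] by (simp add: ennreal_of_nat_eq_real_of_nat[symmetric])
      qed
      then have "of_nat (i + 1) * ennreal s \<le> of_nat (i + 1) * rearrangement {0..} (step_fun x) (real i)"
        by (rule mult_left_mono) simp
      also have "\<dots> \<le> weak_l1_enorm x" unfolding weak_l1_enorm_def by (rule SUP_upper) simp
      finally have "ennreal (real (i + 1) * s) \<le> ennreal r"
        using s by (simp only: r ennreal_of_nat_eq_real_of_nat ennreal_mult of_nat_0_le_iff less_imp_le)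
      then show ?thesis using r(2) Suc by (simp add: mult.commute)
    qed
  qed
  then show "ennreal (weak_norm S a) \<le> weak_l1_enorm x"
    unfolding r by (rule ennreal_leI)
qed

lemma weak_l1_has_copies: "has_weak_l1_copies weak_l1 weak_l1_norm"
  unfolding has_weak_l1_copies_def
proof (intro allI impI)
  fix S :: nat
  define T :: "(nat \<Rightarrow> real) \<Rightarrow> nat \<Rightarrow>\<^sub>C real" where "T a = Bcontfun (\<lambda>i. if i < S then a i else 0)" for a
  have T: "apply_bcontfun (T a) i = (if i < S then a i else 0)" for a i
  proof -
    have "(\<lambda>i. if i < S then a i else 0) \<in> bcontfun"
    proof (rule bcontfun_normI)
      fix i show "norm (if i < S then a i else 0) \<le> (\<Sum>i<S. \<bar>a i\<bar>)"
        using member_le_sum[of i "{..<S}" "\<lambda>i. \<bar>a i\<bar>"] by (auto simp: sum_nonneg)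
    qed simp
    then show ?thesis by (simp add: T_def Bcontfun_inverse)
  qed
  have "T (\<lambda>i. a i + b i) = T a + T b" "T (\<lambda>i. c * a i) = c *\<^sub>R T a" for a b c
    by (auto intro!: bcontfun_eqI simp: T)
  moreover have "weak_l1_enorm (T a) = ennreal (weak_norm S a)" for a
    by (rule weak_l1_enorm_finite_support) (rule T)
  ultimately show "\<exists>\<delta>>0. \<exists>T. scaled_copy weak_l1 weak_l1_norm S \<delta> T"
    using weak_norm_nonneg
    by (intro exI[of _ 1] conjI exI[of _ T]) (auto simp: scaled_copy_def weak_l1_def weak_l1_norm_def)
qed

theorem theorem3:
  fixes I :: "real set"
  assumes "I = {0<..<1} \<or> I = {0<..}"
  shows "\<not> has_type_one (weak_L1 I) (weak_L1_norm I) \<and>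
    \<not> has_type_one weak_l1 weak_l1_norm \<and>
    \<not> normable (weak_L1 I) (weak_L1_norm I) \<and>
    \<not> normable weak_l1 weak_l1_norm"
  using weak_L1_has_copies[OF assms] weak_l1_has_copies
  by (simp add: copies_imp_not_type_one copies_imp_not_normable)

end
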